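(* Let $\mathbf{X}=(X_n)_{n\in\mathbb{Z}}$ be a stationary, almost surely continuous process with values in a finite non-empty alphabet $A$. Let $n\geq 1$ be a sample size and $\delta\in(0,1)$ a confidence parameter, and let $\widehat P_n(\cdot|\cdot)$ be the estimator defined in the context, computed from the sample $X_1^n$ with confidence parameter $\delta$. Then with probability at least $1-\delta$ the following holds: for every $x=x^{-1}_{-\infty}\in A^{\mathbb{Z}_-}$, $$d_{\rm TV}\left(p(\cdot|x),\widehat P_n(\cdot|x)\right)\leq \inf_{L\in\mathbb{N}}\left\{1-\sum_{a\in A}p_-(a|x^{-1}_{-L})+c\,\sqrt{\frac{|A|\,t_{*,n}(\delta)}{N_{n-1}(x^{-1}_{-L})}}\right\},$$ where $c=8+2\sqrt2$.
   Context: Notation. $\mathbb{N}=\{0,1,2,\dots\}$; $A^{\mathbb{Z}_-}$ is the set of infinite pasts $x=(\dots,x_{-2},x_{-1})$; $x^{-1}_{-k}=(x_{-k},\dots,x_{-1})$, equal to the empty string $o$ when $k=0$. $A^*$ is the set of finite strings over $A$ including $o$; $|w|$ is length; $wa$ is concatenation; $w\preceq u$ (or $u\succeq w$) means $w$ is a suffix of $u$. $d_{\rm TV}(p,q)=\frac12\sum_{a\in A}|p(a)-q(a)|$. Convention: $\alpha/0=+\infty$ for $\alpha>0$. Process quantities. $\mathrm{supp}^*(\mathbf{X})=\{w\in A^*:\mathbb{P}(X^{-1}_{-|w|}=w)>0\}$; for $w\in\mathrm{supp}^*(\mathbf{X})$, $p(a|w)=\mathbb{P}(X_0=a\mid X^{-1}_{-|w|}=w)$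 and $p_-(a|w)=\inf_{w'\in\mathrm{supp}^*(\mathbf{X}),w'\succeq w}p(a|w')$; for $w\in A^*\setminus\mathrm{supp}^*(\mathbf{X})$, $p_-(a|w):=p_-(a|u)$ where $u$ is the longest suffix of $w$ in $\mathrm{supp}^*(\mathbf{X})$. $p_-(a|x^{-1}_{-k})$ is nondecreasing in $k$. $\mathbf{X}$ is almost surely continuous if $\mathrm{ct}(X^{-1}_{-k})\to0$ almost surely as $k\to\infty$, where $\mathrm{ct}(w)=\sup_{w'\in\mathrm{supp}^*(\mathbf{X}),w'\succeq w}d_{\rm TV}(p(\cdot|w'),p(\cdot|w))$. The transition probabilities given an infinite past $x\in A^{\mathbb{Z}_-}$ are taken to be the following version: $$p(a|x)=\lim_{k\to\infty}p_-(a|x^{-1}_{-k})+\Big(1-\sum_{b\in A}\lim_{k\to\infty}p_-(b|x^{-1}_{-k})\Big)\frac1{|A|},$$ which is a valid regular version of $\mathbb{P}(X_0=a\mid X^{-1}_{-\infty}=x)$. The estimator. For $w\in A^*$, $N_j(w)=\#\{i: |w|\leq i\leq j,\ X^i_{i-|w|+1}=w\}$ (for $w=o$ the condition is void and $i$ ranges over $0,\dots,j$). For $a\in A$: $\widehat p_n(a|w)=N_n(wa)/N_{n-1}(w)$ if $N_{n-1}(w)>0$, and $1/|A|$ otherwise. Let $$t_{*,n}(\delta)=\ln\left(\frac{|A|\,(14+2\log_2 n)\,(1+\frac{n^2}{2})}{\delta}\right),$$ $$\widehat{\mathsf{cf}}_{n,\delta}(w,a)=2\sqrt{\widehat p_n(a|w)\frac{t_{*,n}(\delta)}{N_{n-1}(w)}}+(2+\sqrt2)\frac{t_{*,n}(\delta)}{N_{n-1}(w)}\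 \text{ if }N_{n-1}(w)>0,\qquad \widehat{\mathsf{cf}}_{n,\delta}(w,a)=1\text{ if }N_{n-1}(w)=0,$$ $$\widehat p_{n,\delta,-}(a|w)=\min_{w'\in A^*,\,w'\succeq w}\left(\widehat p_n(a|w')+\widehat{\mathsf{cf}}_{n,\delta}(w',a)\right).$$ For $x\in A^{\mathbb{Z}_-}$, $\widehat h_n(x)=\min\{h\in\mathbb{N}:\sum_{a\in A}\widehat p_{n,\delta,-}(a|x^{-1}_{-h})\geq1\}$ (always finite). With $h=\widehat h_n(x)$ and the convention that $\widehat p_{n,\delta,-}(a|x^{-1}_{-h+1}):=0$ for all $a$ when $h=0$, let $\widehat Z_n(x)=\sum_{b\in A}(\widehat p_{n,\delta,-}(b|x^{-1}_{-h})-\widehat p_{n,\delta,-}(b|x^{-1}_{-h+1}))>0$, $\widehat z_n(x)=1-\sum_{b\in A}\widehat p_{n,\delta,-}(b|x^{-1}_{-h+1})$, and $$\widehat P_n(a|x)=\Big(1-\frac{\widehat z_n(x)}{\widehat Z_n(x)}\Big)\widehat p_{n,\delta,-}(a|x^{-1}_{-h+1})+\frac{\widehat z_n(x)}{\widehat Z_n(x)}\,\widehat p_{n,\delta,-}(a|x^{-1}_{-h}).$$ *)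

theory Defs
  imports "HOL-Probability.Probability" "HOL-Library.Sublist"
begin

text \<open>
  A sequence indexed by the integers is a function from \<open>int\<close>. An infinite past
  \<open>x = (\<dots>, x (- 2), x (- 1))\<close> is also represented by such a function; everything
  below reads only its values at negative indices. Strings are lists with the oldest symbol
  first, so that \<open>u\<close> is a suffix of \<open>w\<close> in the usual sense iff \<open>suffix u w\<close>.
\<close>

definition block :: "(int \<Rightarrow> 'a) \<Rightarrow> int \<Rightarrow> int \<Rightarrow> 'a list" where
  "block x i j = map x [i..j]"

definition past :: "(int \<Rightarrow> 'a) \<Rightarrow> nat \<Rightarrow> 'a list" where
  "past x k = block x (- int k) (- 1)"

definition dTV :: "('a::finite \<Rightarrow> real) \<Rightarrow> ('a \<Rightarrow> real) \<Rightarrow> real" where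
  "dTV p q = (1 / 2) * (\<Sum>a\<in>UNIV. \<bar>p a - q a\<bar>)"

section \<open>The process\<close>

definition stationary :: "'w measure \<Rightarrow> (int \<Rightarrow> 'w \<Rightarrow> 'a) \<Rightarrow> bool" where
  "stationary M X \<longleftrightarrow> (\<forall>m.
     distr M (\<Pi>\<^sub>M i\<in>UNIV. count_space UNIV) (\<lambda>\<omega> i. X (i + m) \<omega>) =
     distr M (\<Pi>\<^sub>M i\<in>UNIV. count_space UNIV) (\<lambda>\<omega> i. X i \<omega>))"

definition supp :: "'w measure \<Rightarrow> (int \<Rightarrow> 'w \<Rightarrow> 'a) \<Rightarrow> 'a list set" where
  "supp M X = {w. \<P>(\<omega> in M. past (\<lambda>i. X i \<omega>) (length w) = w) > 0}"

definition trans_prob :: "'w measure \<Rightarrow> (int \<Rightarrow> 'w \<Rightarrow> 'a) \<Rightarrow> 'a list \<Rightarrow> 'a \<Rightarrow> real" where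
  "trans_prob M X w a = \<P>(\<omega> in M. X 0 \<omega> = a \<bar> past (\<lambda>i. X i \<omega>) (length w) = w)"

definition p_inf_supp :: "'w measure \<Rightarrow> (int \<Rightarrow> 'w \<Rightarrow> 'a) \<Rightarrow> 'a list \<Rightarrow> 'a \<Rightarrow> real" where
  "p_inf_supp M X w a = (INF w'\<in>{w' \<in> supp M X. suffix w w'}. trans_prob M X w' a)"

definition p_inf :: "'w measure \<Rightarrow> (int \<Rightarrow> 'w \<Rightarrow> 'a) \<Rightarrow> 'a list \<Rightarrow> 'a \<Rightarrow> real" where
  "p_inf M X w a =
     (if w \<in> supp M X then p_inf_supp M X w a
      else p_inf_supp M X (ARG_MAX length u. suffix u w \<and> u \<in> supp M X) a)"

definition ct :: "'w measure \<Rightarrow> (int \<Rightarrow> 'w \<Rightarrow> 'a::finite) \<Rightarrow> 'a list \<Rightarrow> real" where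
  "ct M X w =
     (SUP w'\<in>{w' \<in> supp M X. suffix w w'}. dTV (trans_prob M X w') (trans_prob M X w))"

definition as_continuous :: "'w measure \<Rightarrow> (int \<Rightarrow> 'w \<Rightarrow> 'a::finite) \<Rightarrow> bool" where
  "as_continuous M X \<longleftrightarrow>
     (AE \<omega> in M. (\<lambda>k. ct M X (past (\<lambda>i. X i \<omega>) k)) \<longlonglongrightarrow> 0)"

definition p_limit :: "'w measure \<Rightarrow> (int \<Rightarrow> 'w \<Rightarrow> 'a) \<Rightarrow> (int \<Rightarrow> 'a) \<Rightarrow> 'a \<Rightarrow> real" where
  "p_limit M X x a = lim (\<lambda>k. p_inf M X (past x k) a)"

definition trans_prob_past ::
    "'w measure \<Rightarrow> (int \<Rightarrow> 'w \<Rightarrow> 'a::finite) \<Rightarrow> (int \<Rightarrow> 'a) \<Rightarrow> 'a \<Rightarrow> real" where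
  "trans_prob_past M X x a =
     p_limit M X x a + (1 - (\<Sum>b\<in>UNIV. p_limit M X x b)) * (1 / real CARD('a))"

section \<open>The estimator\<close>

text \<open>
  The argument \<open>s\<close> is the observed sequence; \<open>occ s j w\<close> reads only
  \<open>s 1, \<dots>, s j\<close>, and the estimator \<open>P_hat s n\<close> only \<open>s 1, \<dots>, s n\<close>
  (\<open>P_hat_cong\<close> below).
\<close>

definition occ :: "(int \<Rightarrow> 'a) \<Rightarrow> nat \<Rightarrow> 'a list \<Rightarrow> nat" where
  "occ s j w =
     card {i. length w \<le> i \<and> i \<le> j \<and> block s (int i - int (length w) + 1) (int i) = w}"

definition p_hat :: "(int \<Rightarrow> 'a::finite) \<Rightarrow> nat \<Rightarrow> 'a list \<Rightarrow> 'a \<Rightarrow> real" where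
  "p_hat s n w a =
     (if occ s (n - 1) w > 0 then real (occ s n (w @ [a])) / real (occ s (n - 1) w)
      else 1 / real CARD('a))"

text \<open>The first argument stands for the size of the alphabet.\<close>

definition t_star :: "nat \<Rightarrow> nat \<Rightarrow> real \<Rightarrow> real" where
  "t_star A n \<delta> = ln (real A * (14 + 2 * log 2 (real n)) * (1 + (real n)\<^sup>2 / 2) / \<delta>)"

definition cf_hat :: "(int \<Rightarrow> 'a::finite) \<Rightarrow> nat \<Rightarrow> real \<Rightarrow> 'a list \<Rightarrow> 'a \<Rightarrow> real" where
  "cf_hat s n \<delta> w a =
     (if occ s (n - 1) w > 0
      then 2 * sqrt (p_hat s n w a * (t_star CARD('a) n \<delta> / real (occ s (n - 1) w)))
           + (2 + sqrt 2) * (t_star CARD('a) n \<delta> / real (occ s (n - 1) w))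
      else 1)"

text \<open>
  The minimum ranges over infinitely many strings, but over finitely many values; see
  \<open>finite_p_hat_inf_values\<close> below.
\<close>

definition p_hat_inf :: "(int \<Rightarrow> 'a::finite) \<Rightarrow> nat \<Rightarrow> real \<Rightarrow> 'a list \<Rightarrow> 'a \<Rightarrow> real" where
  "p_hat_inf s n \<delta> w a = Min ((\<lambda>w'. p_hat s n w' a + cf_hat s n \<delta> w' a) ` {w'. suffix w w'})"

definition h_hat :: "(int \<Rightarrow> 'a::finite) \<Rightarrow> nat \<Rightarrow> real \<Rightarrow> (int \<Rightarrow> 'a) \<Rightarrow> nat" where
  "h_hat s n \<delta> x = (LEAST h. (\<Sum>a\<in>UNIV. p_hat_inf s n \<delta> (past x h) a) \<ge> 1)"

definition p_hat_at ::
    "(int \<Rightarrow> 'a::finite) \<Rightarrow> nat \<Rightarrow> real \<Rightarrow> (int \<Rightarrow> 'a) \<Rightarrow> 'a \<Rightarrow> real" where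
  "p_hat_at s n \<delta> x a = p_hat_inf s n \<delta> (past x (h_hat s n \<delta> x)) a"

definition p_hat_before ::
    "(int \<Rightarrow> 'a::finite) \<Rightarrow> nat \<Rightarrow> real \<Rightarrow> (int \<Rightarrow> 'a) \<Rightarrow> 'a \<Rightarrow> real" where
  "p_hat_before s n \<delta> x a =
     (if h_hat s n \<delta> x = 0 then 0 else p_hat_inf s n \<delta> (past x (h_hat s n \<delta> x - 1)) a)"

definition Z_hat :: "(int \<Rightarrow> 'a::finite) \<Rightarrow> nat \<Rightarrow> real \<Rightarrow> (int \<Rightarrow> 'a) \<Rightarrow> real" where
  "Z_hat s n \<delta> x = (\<Sum>b\<in>UNIV. p_hat_at s n \<delta> x b - p_hat_before s n \<delta> x b)"

definition z_hat :: "(int \<Rightarrow> 'a::finite) \<Rightarrow> nat \<Rightarrow> real \<Rightarrow> (int \<Rightarrow> 'a) \<Rightarrow> real" where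
  "z_hat s n \<delta> x = 1 - (\<Sum>b\<in>UNIV. p_hat_before s n \<delta> x b)"

definition P_hat ::
    "(int \<Rightarrow> 'a::finite) \<Rightarrow> nat \<Rightarrow> real \<Rightarrow> (int \<Rightarrow> 'a) \<Rightarrow> 'a \<Rightarrow> real" where
  "P_hat s n \<delta> x a =
     (1 - z_hat s n \<delta> x / Z_hat s n \<delta> x) * p_hat_before s n \<delta> x a
     + z_hat s n \<delta> x / Z_hat s n \<delta> x * p_hat_at s n \<delta> x a"

text \<open>
  \<open>sqrt_ratio \<alpha> m\<close> is the square root of \<open>\<alpha> / m\<close> under the convention
  \<open>\<alpha> / 0 = \<infinity>\<close> for \<open>\<alpha> > 0\<close>.
\<close>

definition sqrt_ratio :: "real \<Rightarrow> nat \<Rightarrow> ereal" where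
  "sqrt_ratio \<alpha> m = (if m = 0 then \<infinity> else ereal (sqrt (\<alpha> / real m)))"

section \<open>Well-definedness\<close>

lemma length_past [simp]: "length (past x k) = k"
  by (simp add: past_def block_def)

lemma Nil_in_supp:
  assumes "prob_space M"
  shows "[] \<in> supp M X"
  using assms by (simp add: supp_def past_def block_def prob_space.prob_space)

lemma longest_suffix_in_supp:
  fixes M X w
  assumes "prob_space M"
  defines "u \<equiv> ARG_MAX length u. suffix u w \<and> u \<in> supp M X"
  shows "suffix u w \<and> u \<in> supp M X"
    and "suffix v w \<Longrightarrow> v \<in> supp M X \<Longrightarrow> length v \<le> length u"
proof -
  let ?P = "\<lambda>u. suffix u w \<and> u \<in> supp M X"
  have P: "?P []"
    using Nil_in_supp [OF assms(1)] by simp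
  have b: "\<forall>y. ?P y \<longrightarrow> length y < Suc (length w)"
    by (auto dest: suffix_length_le)
  show "?P u"
    unfolding u_def using arg_max_natI [of ?P, OF P b] .
  show "length v \<le> length u" if "suffix v w" "v \<in> supp M X"
    unfolding u_def using arg_max_nat_le [of ?P v length "Suc (length w)"] that b by blast
qed

lemma occ_eq_0: "j < length w \<Longrightarrow> occ s j w = 0"
  by (auto simp: occ_def)

lemma occ_cong:
  assumes "\<And>i. 1 \<le> i \<Longrightarrow> i \<le> int j \<Longrightarrow> s i = s' i"
  shows "occ s j w = occ s' j w"
proof -
  have "block s (int i - int (length w) + 1) (int i) = block s' (int i - int (length w) + 1) (int i)"
    if "length w \<le> i" "i \<le> j" for i
    using that by (auto simp: block_def intro!: assms)
  then show ?thesis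
    unfolding occ_def by (intro arg_cong [of _ _ card]) auto
qed

lemma P_hat_cong:
  assumes "\<And>i. 1 \<le> i \<Longrightarrow> i \<le> int n \<Longrightarrow> s i = s' i"
  shows "P_hat s n = P_hat s' n"
proof -
  have "occ s n = occ s' n" "occ s (n - 1) = occ s' (n - 1)"
    using assms by (auto intro!: ext occ_cong)
  then have p: "p_hat s n = p_hat s' n"
    by (simp add: p_hat_def fun_eq_iff)
  then have "cf_hat s n = cf_hat s' n"
    using \<open>occ s (n - 1) = occ s' (n - 1)\<close> by (simp add: cf_hat_def fun_eq_iff)
  then have "p_hat_inf s n = p_hat_inf s' n"
    using p by (simp add: p_hat_inf_def fun_eq_iff)
  then show ?thesis
    by (simp add: P_hat_def Z_hat_def z_hat_def p_hat_at_def p_hat_before_def h_hat_def fun_eq_iff)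
qed

lemma finite_p_hat_inf_values:
  "finite ((\<lambda>w'. p_hat s n w' a + cf_hat s n \<delta> w' a) ` S)"
proof (rule finite_subset)
  let ?f = "\<lambda>w'. p_hat s n w' a + cf_hat s n \<delta> w' a"
  let ?F = "{w :: 'a list. set w \<subseteq> UNIV \<and> length w \<le> n}"
  show "?f ` S \<subseteq> insert (1 / real CARD('a) + 1) (?f ` ?F)"
  proof
    fix v assume "v \<in> ?f ` S"
    then obtain w where w: "v = ?f w" by blast
    show "v \<in> insert (1 / real CARD('a) + 1) (?f ` ?F)"
    proof (cases "length w \<le> n")
      case True
      then show ?thesis using w by auto
    next
      case False
      then have "occ s (n - 1) w = 0" by (intro occ_eq_0) simp
      then show ?thesis using w by (simp add: p_hat_def cf_hat_def)
    qed
  qed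
  show "finite (insert (1 / real CARD('a) + 1) (?f ` ?F))"
    using finite_lists_length_le [of "UNIV :: 'a set" n] by simp
qed

lemma h_hat_exists:
  fixes s x :: "int \<Rightarrow> 'a::finite"
  shows "(\<Sum>a\<in>UNIV. p_hat_inf s n \<delta> (past x (Suc n)) a) \<ge> 1"
proof -
  have "p_hat_inf s n \<delta> (past x (Suc n)) a = 1 / real CARD('a) + 1" for a
  proof -
    have "p_hat s n w a + cf_hat s n \<delta> w a = 1 / real CARD('a) + 1"
      if "suffix (past x (Suc n)) w" for w
    proof -
      have "n - 1 < length w"
        using suffix_length_le [OF that] by simp
      then show ?thesis
        by (simp add: p_hat_def cf_hat_def occ_eq_0)
    qed
    then have "(\<lambda>w. p_hat s n w a + cf_hat s n \<delta> w a) ` {w. suffix (past x (Suc n)) w}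
        = {1 / real CARD('a) + 1}"
      by auto
    then show ?thesis by (simp add: p_hat_inf_def)
  qed
  then show ?thesis by (simp add: distrib_left)
qed

lemma Z_hat_pos: "Z_hat s n \<delta> x > 0"
proof -
  let ?S = "\<lambda>h. \<Sum>a\<in>UNIV. p_hat_inf s n \<delta> (past x h) a"
  have at: "?S (h_hat s n \<delta> x) \<ge> 1"
    unfolding h_hat_def by (rule LeastI [of "\<lambda>h. ?S h \<ge> 1"]) (rule h_hat_exists)
  have before: "?S h < 1" if "h < h_hat s n \<delta> x" for h
    using not_less_Least [of h "\<lambda>h. ?S h \<ge> 1"] that by (simp add: h_hat_def)
  show ?thesis
    using at before [of "h_hat s n \<delta> x - 1"]
    by (cases "h_hat s n \<delta> x = 0")
       (simp_all add: Z_hat_def p_hat_at_def p_hat_before_def sum_subtractf)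
qed

end

theory Submission
  imports Defs
begin

text \<open>
  Only one inequality has to hold with high probability: \<open>p_hat + cf_hat\<close> dominates
  \<open>p_inf\<close> for every word and letter simultaneously. Since \<open>p_inf\<close> is
  monotone in the word, \<open>p_hat_inf\<close> then dominates it too. Fix \<open>L\<close>. If
  \<open>L < h_hat\<close>, both distributions dominate \<open>p_inf\<close> at depth \<open>L\<close>,
  so their distance is at most its missing mass. Otherwise \<open>P_hat\<close> lies below
  \<open>p_hat + cf_hat\<close> at depth \<open>L\<close>, and Cauchy-Schwarz bounds the sum of the
  \<open>cf_hat\<close>.

  The inequality itself is a Chernoff bound with a union bound over the letter, the first
  occurrence of the word in the sample and a dyadic grid of exponents. Given a finite past
  \<open>u\<close> with suffix \<open>w\<close>, the next letter is \<open>a\<close> with probability at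
  least \<open>p_inf w a\<close>, so conditioning on infinite pasts is never needed.
\<close>

section \<open>Words and blocks\<close>

lemma block_shift: "block (\<lambda>i. y (i + m)) i j = block y (i + m) (j + m)"
  unfolding block_def
  by (rule nth_equalityI) (auto simp: nth_upto algebra_simps)

lemma block_snoc: "i \<le> j + 1 \<Longrightarrow> block y i (j + 1) = block y i j @ [y (j + 1)]"
  unfolding block_def using upto_rec2 [of i "j + 1"] by simp

lemma length_block [simp]: "length (block y i j) = nat (j - i + 1)"
  by (simp add: block_def)

lemma suffix_past: "k \<le> m \<Longrightarrow> suffix (past x k) (past x m)"
proof -
  assume "k \<le> m"
  then have "past x m = block x (- int m) (- int k - 1) @ past x k"
    unfolding past_def block_def
    using upto_split1 [of "- int m" "- int k" "-1"]
    by (cases "k = 0") (auto simp flip: map_append)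
  then show ?thesis by (simp add: suffixI)
qed

lemma take_block: "i \<le> n \<Longrightarrow> take i (block s 1 (int n)) = block s 1 (int i)"
  by (rule nth_equalityI) (auto simp: block_def nth_upto)

lemma suffix_block_iff:
  assumes "length w \<le> i"
  shows "suffix w (block s 1 (int i)) \<longleftrightarrow> block s (int i - int (length w) + 1) (int i) = w"
proof -
  let ?b = "block s (int i - int (length w) + 1) (int i)"
  have "[1..int i] = [1..int i - int (length w)] @ [int i - int (length w) + 1..int i]"
    using assms upto_split1 [of 1 "int i - int (length w) + 1" "int i"]
      upto_rec2 [of "int i + 1" "int i"]
    by (cases "length w = 0") auto
  then have split: "block s 1 (int i) = block s 1 (int i - int (length w)) @ ?b"
    by (simp add: block_def)
  show ?thesis
  proof
    assume "suffix w (block s 1 (int i))"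
    then obtain v where "v @ w = block s 1 (int i - int (length w)) @ ?b"
      unfolding split by (metis suffix_def)
    then show "?b = w"
      by (subst (asm) append_eq_append_conv) auto
  next
    assume "?b = w"
    then show "suffix w (block s 1 (int i))"
      unfolding split by (simp add: suffixI)
  qed
qed

text \<open>The lower bound \<open>length w \<le> i\<close> is automatic here, because the block has
  only \<open>i\<close> letters.\<close>

lemma occ_eq_card_suffix: "occ s j w = card {i. i \<le> j \<and> suffix w (block s 1 (int i))}"
proof -
  have "length w \<le> i" if "suffix w (block s 1 (int i))" for i
    using suffix_length_le [OF that] by simp
  then show ?thesis
    unfolding occ_def
    by (intro arg_cong [of _ _ card]) (use suffix_block_iff in blast)
qed

text \<open>The times \<open>i\<close> at which \<open>w\<close> has just been read while the next
  letter \<open>u ! i\<close> still lies in the sample; hence \<open>i < length u\<close>. The empty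
  word counts as visited at time 0.\<close>

definition visits :: "'a list \<Rightarrow> 'a list \<Rightarrow> nat set" where
  "visits w u = {i. i < length u \<and> suffix w (take i u)}"

lemma finite_visits [simp]: "finite (visits w u)"
  by (simp add: visits_def)

lemma occ_eq_card_visits:
  assumes "n \<ge> 1"
  shows "occ s (n - 1) w = card (visits w (block s 1 (int n)))"
  unfolding occ_eq_card_suffix visits_def
proof (intro arg_cong [of _ _ card] Collect_cong conj_cong)
  show "i \<le> n - 1 \<longleftrightarrow> i < length (block s 1 (int n))" for i
    using assms by auto
  show "suffix w (block s 1 (int i)) \<longleftrightarrow> suffix w (take i (block s 1 (int n)))"
    if "i < length (block s 1 (int n))" for i
    using that by (simp add: take_block)
qed

text \<open>Sample times start at 1 and list indices at 0: an occurrence of \<open>w @ [a]\<close>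
  ending at \<open>Suc k\<close> is a visit at \<open>k\<close> with next letter
  \<open>u ! k = a\<close>.\<close>

lemma occ_snoc_eq_card_visits:
  assumes "n \<ge> 1"
  shows "occ s n (w @ [a]) =
    card {i \<in> visits w (block s 1 (int n)). block s 1 (int n) ! i = a}"
proof -
  let ?u = "block s 1 (int n)"
  have *: "suffix (w @ [a]) (block s 1 (int (Suc i))) \<longleftrightarrow> suffix w (block s 1 (int i)) \<and> s (int i + 1) = a"
    for i
    using block_snoc [of 1 "int i" s] by (auto simp: add.commute)
  have "{i. i \<le> n \<and> suffix (w @ [a]) (block s 1 (int i))} = Suc ` {i \<in> visits w ?u. ?u ! i = a}"
  proof (intro set_eqI iffI)
    fix i assume i: "i \<in> {i. i \<le> n \<and> suffix (w @ [a]) (block s 1 (int i))}"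
    then have "i \<noteq> 0" by (auto dest: suffix_length_le)
    then obtain k where k: "i = Suc k" by (cases i) auto
    have "?u ! k = s (int k + 1)" using i k by (simp add: block_def nth_upto add.commute)
    then show "i \<in> Suc ` {i \<in> visits w ?u. ?u ! i = a}"
      using i k * [of k] by (auto simp: visits_def take_block)
  next
    fix i assume "i \<in> Suc ` {i \<in> visits w ?u. ?u ! i = a}"
    then obtain k where k: "i = Suc k" "k \<in> visits w ?u" "?u ! k = a" by auto
    then have "k < n" by (simp add: visits_def)
    then have "?u ! k = s (int k + 1)" by (simp add: block_def nth_upto add.commute)
    then show "i \<in> {i. i \<le> n \<and> suffix (w @ [a]) (block s 1 (int i))}"
      using k * [of k] \<open>k < n\<close> by (auto simp: visits_def take_block)
  qed
  then show ?thesis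
    by (simp add: occ_eq_card_suffix card_image)
qed

section \<open>Sums over words of fixed length\<close>

lemma finite_words [simp]: "finite {u :: 'a::finite list. length u = m}"
  using finite_lists_length_eq [of "UNIV :: 'a set" m] by simp

lemma sum_words_Suc:
  fixes f :: "'a::finite list \<Rightarrow> real"
  shows "(\<Sum>u | length u = Suc m. f u) = (\<Sum>u | length u = m. \<Sum>b\<in>UNIV. f (u @ [b]))"
proof -
  have "(\<Sum>u | length u = m. \<Sum>b\<in>UNIV. f (u @ [b]))
      = (\<Sum>(u, b)\<in>{u. length u = m} \<times> UNIV. f (u @ [b]))"
    by (rule sum.cartesian_product)
  also have "\<dots> = (\<Sum>u | length u = Suc m. f u)"
  proof (rule sum.reindex_bij_witness [where j = "\<lambda>(u, b). u @ [b]" and i = "\<lambda>u. (butlast u, last u)"])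
    fix u :: "'a list" assume "u \<in> {u. length u = Suc m}"
    then have "u \<noteq> []" by auto
    then show "(case (butlast u, last u) of (u, b) \<Rightarrow> u @ [b]) = u" by simp
  qed auto
  finally show ?thesis by simp
qed

section \<open>Concentration\<close>

text \<open>Equivalently \<open>exp (- x) \<le> 1 - x + x^2 / 2\<close>. Multiply by
  \<open>exp x \<ge> 1 + x + x^2 / 2\<close>: the two quadratics have product
  \<open>1 + x^4 / 4\<close>.\<close>

lemma one_minus_exp_minus_ge:
  fixes x :: real
  assumes "0 \<le> x"
  shows "x - x\<^sup>2 / 2 \<le> 1 - exp (- x)"
proof -
  have "(1 - x + x\<^sup>2 / 2) * (1 + x + x\<^sup>2 / 2) = 1 + (x\<^sup>2)\<^sup>2 / 4"
    by (simp add: power2_eq_square algebra_simps)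
  then have "1 \<le> (1 - x + x\<^sup>2 / 2) * (1 + x + x\<^sup>2 / 2)"
    by simp
  also have "\<dots> \<le> (1 - x + x\<^sup>2 / 2) * exp x"
  proof (rule mult_left_mono)
    show "1 + x + x\<^sup>2 / 2 \<le> exp x"
      using exp_lower_Taylor_quadratic [OF assms] .
    have "0 \<le> (1 - x)\<^sup>2" by simp
    then show "0 \<le> 1 - x + x\<^sup>2 / 2" by (simp add: power2_eq_square algebra_simps)
  qed
  finally show ?thesis by (simp add: exp_minus field_simps)
qed

text \<open>
  The optimal exponent for \<open>V\<close> is about \<open>sqrt (2 * t / V)\<close>; replacing
  \<open>V\<close> by the power of two below it costs a factor that the constants absorb.
\<close>

lemma exponent_grid:
  fixes S V t N :: real
  assumes "0 \<le> S" and "1 \<le> t" and gap: "S + 2 * sqrt (S * t) + (2 + sqrt 2) * t < V" and "V \<le> N"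
  shows "\<exists>k\<le>nat \<lfloor>log 2 N\<rfloor>. t \<le> (1 - exp (- sqrt (2 * t / 2 ^ k))) * V - sqrt (2 * t / 2 ^ k) * S"
proof -
  have sq2: "sqrt 2 \<ge> 1" by simp
  have "(2 + sqrt 2) * t \<ge> 3 * t"
    using sq2 assms(2) by (intro mult_right_mono) auto
  moreover have root: "sqrt (S * t) \<ge> 0" using assms by simp
  ultimately have D: "V - S \<ge> 2 * sqrt (S * t) + 3 * t" and V: "V \<ge> 1" and VS: "V \<ge> S"
    using gap assms by linarith+
  define k where "k = nat \<lfloor>log 2 V\<rfloor>"
  define v :: real where "v = 2 ^ k"
  define r where "r = sqrt (2 * t / v)"
  have k: "real k = of_int \<lfloor>log 2 V\<rfloor>" using V by (simp add: k_def)
  have v_powr: "v = 2 powr real k" by (simp add: v_def powr_realpow)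
  have "v \<le> V" using V by (simp add: v_powr k powr_le_iff)
  moreover have "V \<le> 2 powr (real k + 1)"
    using V less_imp_le [OF floor_correct [of "log 2 V", THEN conjunct2]]
    by (simp add: k le_powr_iff)
  then have "V \<le> 2 * v" by (simp add: v_powr powr_add)
  moreover have "v > 0" by (simp add: v_def)
  \<comment> \<open>The sign comes from \<open>v \<le> V \<le> 2 * v\<close>. Expanded, this bounds
    \<open>(v + V)^2\<close> by \<open>9 / 2 * (v * V)\<close>, with equality at
    \<open>V = 2 * v\<close>; for \<open>v = V\<close> the factor would be 4, so rounding costs at
    most 9/8.\<close>
  ultimately have "(V - 2 * v) * (V - v / 2) \<le> 0"
    by (intro mult_nonpos_nonneg) auto
  then have vV: "(v + V)\<^sup>2 \<le> 9 / 2 * (v * V)"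
    by (simp add: power2_eq_square algebra_simps)
  \<comment> \<open>The aim is \<open>9 / 4 * (V * t) \<le> (V - S)^2\<close>. Writing
    \<open>V\<close> as \<open>S + (V - S)\<close> reduces it to
    \<open>9 / 4 * (S * t) \<le> (V - S) * (V - S - 9 / 4 * t)\<close>, and by \<open>D\<close> both
    factors are at least \<open>2 * sqrt (S * t)\<close>.\<close>
  have "9 / 4 * (S * t) \<le> 4 * (S * t)"
    using assms by (intro mult_right_mono) auto
  also have "\<dots> = (2 * sqrt (S * t)) * (2 * sqrt (S * t))"
    using assms by simp
  also have "\<dots> \<le> (V - S) * (V - S - 9 / 4 * t)"
    using D VS root assms(2) by (intro mult_mono) linarith+
  also have "\<dots> = (V - S)\<^sup>2 - 9 / 4 * (V * t) + 9 / 4 * (S * t)"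
    by (simp add: power2_eq_square field_simps)
  finally have "9 / 4 * (V * t) \<le> (V - S)\<^sup>2" by simp
  then have "2 * v * (9 / 4 * (V * t)) \<le> 2 * v * (V - S)\<^sup>2"
    using \<open>v > 0\<close> by (intro mult_left_mono) auto
  moreover have "t * (v + V)\<^sup>2 \<le> t * (9 / 2 * (v * V))"
    using vV assms by (intro mult_left_mono) auto
  ultimately have "t * (v + V)\<^sup>2 \<le> 2 * v * (V - S)\<^sup>2"
    by (simp add: algebra_simps)
  then have "t / v\<^sup>2 * (t * (v + V)\<^sup>2) \<le> t / v\<^sup>2 * (2 * v * (V - S)\<^sup>2)"
    using assms by (intro mult_left_mono) auto
  moreover have "t * (1 + V / v) = t * (v + V) / v"
    using \<open>v > 0\<close> by (simp add: field_simps)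
  then have "(t * (1 + V / v))\<^sup>2 = t / v\<^sup>2 * (t * (v + V)\<^sup>2)"
    by (simp add: power_divide power_mult_distrib power2_eq_square)
  moreover have "t / v\<^sup>2 * (2 * v * (V - S)\<^sup>2) = (2 * t / v) * (V - S)\<^sup>2"
    using \<open>v > 0\<close> by (simp add: power2_eq_square)
  ultimately have "(t * (1 + V / v))\<^sup>2 \<le> (2 * t / v) * (V - S)\<^sup>2"
    by simp
  also have "\<dots> = (r * (V - S))\<^sup>2"
    using \<open>v > 0\<close> assms by (simp add: r_def power_mult_distrib)
  finally have "t * (1 + V / v) \<le> r * (V - S)"
    by (rule power2_le_imp_le) (use VS assms \<open>v > 0\<close> in \<open>simp add: r_def\<close>)
  moreover have "r\<^sup>2 = 2 * t / v" using \<open>v > 0\<close> assms by (simp add: r_def)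
  then have "(r - r\<^sup>2 / 2) * V = r * V - t * (V / v)" by (simp add: algebra_simps)
  \<comment> \<open>Since \<open>r^2 / 2 = t / v\<close>, this is a rearrangement of
    \<open>t * (1 + V / v) \<le> r * (V - S)\<close>, which was obtained by comparing
    squares.\<close>
  ultimately have "t \<le> (r - r\<^sup>2 / 2) * V - r * S"
    unfolding distrib_left right_diff_distrib by linarith
  also have "\<dots> \<le> (1 - exp (- r)) * V - r * S"
    using V \<open>v > 0\<close> assms by (intro diff_right_mono mult_right_mono one_minus_exp_minus_ge) (auto simp: r_def)
  finally have "t \<le> (1 - exp (- r)) * V - r * S" .
  moreover have "k \<le> nat \<lfloor>log 2 N\<rfloor>"
    unfolding k_def using V assms by (intro nat_mono floor_mono) simp
  ultimately show ?thesis unfolding r_def v_def by blast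
qed

text \<open>\<open>Q u\<close> stands for the probability that the sample starts with
  \<open>u\<close>, and \<open>p w\<close> for a lower bound on the next-letter probabilities that
  holds whatever precedes \<open>w\<close>. In product form \<open>p_le\<close> also covers words of
  probability zero.\<close>

locale word_chain =
  fixes Q :: "'a::finite list \<Rightarrow> real" and p :: "'a list \<Rightarrow> 'a \<Rightarrow> real"
  assumes Q_nonneg: "0 \<le> Q u"
    and Q_Nil: "Q [] = 1"
    and Q_snoc: "(\<Sum>b\<in>UNIV. Q (u @ [b])) = Q u"
    and p_le: "suffix w u \<Longrightarrow> p w a * Q u \<le> Q (u @ [a])"
    and p_le_1: "p w a \<le> 1"
begin

lemma sum_Q: "(\<Sum>u | length u = m. Q u) = 1"
proof (induction m)
  case (Suc m)
  then show ?case by (simp add: sum_words_Suc Q_snoc)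
qed (simp add: Q_Nil)

text \<open>
  The word whose visits are counted is itself read off the sample: it has length \<open>l\<close> and
  ends at position \<open>j\<close>. From time \<open>j\<close> on it is known, so \<open>weight\<close> is an exponential
  supermartingale; this is why a union bound over the positions \<open>(l, j)\<close> replaces one
  over all words.
\<close>

definition weight :: "nat \<Rightarrow> nat \<Rightarrow> 'a \<Rightarrow> real \<Rightarrow> 'a list \<Rightarrow> real" where
  "weight l j a r u =
     (let w = drop (j - l) (take j u) in
      exp (\<Sum>i\<in>{j..<length u}. of_bool (suffix w (take i u))
             * ((1 - exp (- r)) * p w a - r * of_bool (u ! i = a))))"

text \<open>A letter appended after time \<open>j\<close> leaves the tracked word unchanged, so the
  exponent gains a single summand, the one for \<open>i = length u\<close>.\<close>

lemma weight_snoc: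
  fixes j l :: nat
  assumes "j \<le> length u"
  defines "w \<equiv> drop (j - l) (take j u)"
  shows "weight l j a r (u @ [b]) = weight l j a r u *
    (if suffix w u then exp ((1 - exp (- r)) * p w a - r * of_bool (b = a)) else 1)"
proof -
  have "(\<Sum>i\<in>{j..<length u}. of_bool (suffix w (take i (u @ [b])))
             * ((1 - exp (- r)) * p w a - r * of_bool ((u @ [b]) ! i = a)))
      = (\<Sum>i\<in>{j..<length u}. of_bool (suffix w (take i u))
             * ((1 - exp (- r)) * p w a - r * of_bool (u ! i = a)))"
    by (intro sum.cong) (auto simp: nth_append)
  then show ?thesis
    using assms(1) unfolding weight_def w_def by (simp add: Let_def exp_add)
qed

text \<open>At \<open>m = j\<close> every weight is 1. Later, if \<open>a\<close> follows with
  conditional probability \<open>q \<ge> p w a\<close>, a visit multiplies the mean weight by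
  \<open>exp (c * p w a) * (1 - c * q)\<close> with \<open>c = 1 - exp (- r)\<close>, which is at
  most 1 by \<open>1 + x \<le> exp x\<close>.\<close>

lemma sum_weight_le:
  assumes "j \<le> m" and "0 \<le> r"
  shows "(\<Sum>u | length u = m. Q u * weight l j a r u) \<le> 1"
  using assms(1)
proof (induction m rule: dec_induct)
  case base
  then show ?case by (simp add: weight_def Let_def sum_Q)
next
  case (step m)
  have "(\<Sum>b\<in>UNIV. Q (u @ [b]) * weight l j a r (u @ [b])) \<le> Q u * weight l j a r u"
    if "length u = m" for u
  proof -
    define w where "w = drop (j - l) (take j u)"
    define c where "c = 1 - exp (- r)"
    let ?f = "\<lambda>b. if suffix w u then exp (c * p w a - r * of_bool (b = a)) else 1"
    have "(\<Sum>b\<in>UNIV. Q (u @ [b]) * ?f b) \<le> Q u"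
    proof (cases "suffix w u")
      case True
      have expr: "exp (c * p w a - r) = exp (c * p w a) * (1 - c)"
        by (simp add: c_def exp_diff exp_minus divide_inverse)
      have "(\<Sum>b\<in>UNIV. Q (u @ [b]) * ?f b)
          = (\<Sum>b\<in>UNIV. exp (c * p w a) * (Q (u @ [b]) - (if b = a then c * Q (u @ [b]) else 0)))"
        using True expr by (intro sum.cong) (auto simp: right_diff_distrib)
      also have "\<dots> = exp (c * p w a) * (Q u - c * Q (u @ [a]))"
        by (simp add: sum_distrib_left [symmetric] sum_subtractf Q_snoc)
      also have "\<dots> \<le> exp (c * p w a) * (Q u - c * (p w a * Q u))"
        using p_le [OF True, of a] assms(2) by (intro mult_left_mono diff_left_mono) (auto simp: c_def)
      also have "\<dots> = exp (c * p w a) * (1 + - (c * p w a)) * Q u"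
        by (simp add: algebra_simps)
      also have "\<dots> \<le> exp (c * p w a) * exp (- (c * p w a)) * Q u"
        by (intro mult_right_mono mult_left_mono exp_ge_add_one_self Q_nonneg) auto
      finally show ?thesis by (simp add: exp_minus)
    qed (simp add: Q_snoc)
    then have "(\<Sum>b\<in>UNIV. Q (u @ [b]) * ?f b) * weight l j a r u \<le> Q u * weight l j a r u"
      by (intro mult_right_mono) (auto simp: weight_def Let_def)
    moreover have "(\<Sum>b\<in>UNIV. Q (u @ [b]) * weight l j a r (u @ [b]))
        = (\<Sum>b\<in>UNIV. Q (u @ [b]) * ?f b) * weight l j a r u"
      unfolding sum_distrib_right
      using that step.hyps by (intro sum.cong) (simp_all add: weight_snoc w_def c_def)
    ultimately show ?thesis by simp
  qed
  then have "(\<Sum>u | length u = Suc m. Q u * weight l j a r u) \<le> (\<Sum>u | length u = m. Q u * weight l j a r u)"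
    unfolding sum_words_Suc by (intro sum_mono) auto
  with step.IH show ?case by simp
qed

text \<open>Markov's inequality for the weight, whose mean is at most 1.\<close>

lemma sum_weight_large_le:
  assumes "j \<le> m" and "0 \<le> r"
  shows "(\<Sum>u | length u = m. Q u * of_bool (exp t \<le> weight l j a r u)) \<le> exp (- t)"
proof -
  have "(\<Sum>u | length u = m. Q u * of_bool (exp t \<le> weight l j a r u))
      \<le> (\<Sum>u | length u = m. exp (- t) * (Q u * weight l j a r u))"
  proof (intro sum_mono)
    fix u
    have "of_bool (exp t \<le> weight l j a r u) \<le> exp (- t) * weight l j a r u"
      by (auto simp: exp_minus field_simps weight_def Let_def)
    then have "Q u * of_bool (exp t \<le> weight l j a r u) \<le> Q u * (exp (- t) * weight l j a r u)"
      by (intro mult_left_mono Q_nonneg)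
    then show "Q u * of_bool (exp t \<le> weight l j a r u) \<le> exp (- t) * (Q u * weight l j a r u)"
      by (simp add: algebra_simps)
  qed
  also have "\<dots> \<le> exp (- t) * 1"
    unfolding sum_distrib_left [symmetric]
    by (intro mult_left_mono sum_weight_le assms) auto
  finally show ?thesis by simp
qed

text \<open>The word is the last \<open>length w\<close> letters read at its first visit
  \<open>j\<close>, and no visit precedes \<open>j\<close>, so the exponent involves the full
  counts.\<close>

lemma weight_first_visit:
  assumes "visits w u \<noteq> {}"
  defines "j \<equiv> Min (visits w u)"
  shows "weight (length w) j a r u =
    exp ((1 - exp (- r)) * (real (card (visits w u)) * p w a)
         - r * real (card {i \<in> visits w u. u ! i = a}))"
proof -
  let ?d = "\<lambda>i. (1 - exp (- r)) * p w a - r * of_bool (u ! i = a)"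
  have j: "j \<in> visits w u"
    unfolding j_def using assms(1) by (intro Min_in) auto
  then have jl: "j < length u" and sj: "suffix w (take j u)"
    by (auto simp: visits_def)
  from sj obtain v where v: "take j u = v @ w"
    by (auto simp: suffix_def)
  have "j = length v + length w"
    using arg_cong [OF v, of length] jl by simp
  then have "j - length w = length v" by simp
  then have w: "drop (j - length w) (take j u) = w"
    by (simp add: v)
  have "visits w u \<subseteq> {j..<length u}"
    unfolding j_def by (auto simp: visits_def)
  then have "(\<Sum>i\<in>{j..<length u}. of_bool (suffix w (take i u)) * ?d i) = (\<Sum>i\<in>visits w u. ?d i)"
    by (intro sum.mono_neutral_cong_right) (auto simp: visits_def)
  also have "\<dots> = (1 - exp (- r)) * (real (card (visits w u)) * p w a)
         - r * real (card {i \<in> visits w u. u ! i = a})"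
    by (simp add: sum_subtractf sum_distrib_left [symmetric] sum_of_bool_eq Int_def)
  finally show ?thesis by (simp add: weight_def w Let_def)
qed

text \<open>Failure of the upper confidence bound for some visited word, multiplied by the number of
  visits; in this form it is the gap assumed in \<open>exponent_grid\<close>.\<close>

definition underestimated :: "real \<Rightarrow> 'a list \<Rightarrow> bool" where
  "underestimated t u \<longleftrightarrow> (\<exists>w a. visits w u \<noteq> {} \<and>
     (let S = real (card {i \<in> visits w u. u ! i = a}) in
       S + 2 * sqrt (S * t) + (2 + sqrt 2) * t < real (card (visits w u)) * p w a))"

lemma sum_underestimated_le:
  assumes "n \<ge> 1" and "t \<ge> 1"
  shows "(\<Sum>u | length u = n. Q u * of_bool (underestimated t u))
    \<le> (1 + (real n)\<^sup>2 / 2) * real CARD('a) * (1 + log 2 (real n)) * exp (- t)"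
proof -
  \<comment> \<open>Pairs of first visit \<open>j\<close> and word length \<open>l\<close>. A
    nonempty word needs \<open>1 \<le> l \<le> j < n\<close>; the empty word is first visited at 0
    and contributes only \<open>(0, 0)\<close>. This makes \<open>n * (n - 1) / 2 + 1\<close>
    pairs.\<close>
  define P where "P = insert (0, 0) (SIGMA j:{..<n}. {1..j})"
  define K where "K = nat \<lfloor>log 2 (real n)\<rfloor>"
  define I where "I = P \<times> (UNIV :: 'a set) \<times> {..K}"
  define large where "large = (\<lambda>((j, l), a, k) u. exp t \<le> weight l j a (sqrt (2 * t / 2 ^ k)) u)"
  have "finite I" by (simp add: I_def P_def)
  have "2 * real (\<Sum>j<n. j) \<le> (real n)\<^sup>2"
    by (induction n) (auto simp: power2_eq_square algebra_simps)
  then have "real (card P) \<le> 1 + (real n)\<^sup>2 / 2"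
    unfolding P_def by (subst card_insert_disjoint) auto
  moreover have "1 + real K \<le> 1 + log 2 (real n)"
    using assms(1) by (simp add: K_def)
  ultimately have "real (card P) * real CARD('a) * (1 + real K)
      \<le> (1 + (real n)\<^sup>2 / 2) * real CARD('a) * (1 + log 2 (real n))"
    by (intro mult_mono) auto
  moreover have "real (card I) = real (card P) * real CARD('a) * (1 + real K)"
    by (simp add: I_def card_cartesian_product algebra_simps)
  ultimately have cardI: "real (card I) \<le> (1 + (real n)\<^sup>2 / 2) * real CARD('a) * (1 + log 2 (real n))"
    by simp
  have "\<exists>x\<in>I. large x u" if u: "length u = n" "underestimated t u" for u
  proof -
    from u(2) obtain w a where ne: "visits w u \<noteq> {}"
      and lt: "let S = real (card {i \<in> visits w u. u ! i = a}) in
        S + 2 * sqrt (S * t) + (2 + sqrt 2) * t < real (card (visits w u)) * p w a"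
      unfolding underestimated_def by blast
    have "card (visits w u) \<le> n"
      using card_mono [of "{..<n}" "visits w u"] u(1) by (auto simp: visits_def)
    \<comment> \<open>The expected count never exceeds \<open>n\<close>, so the same grid of
      exponents up to \<open>K\<close> serves all words and letters.\<close>
    then have "real (card (visits w u)) * p w a \<le> real n * 1"
      by (intro order.trans [OF mult_left_mono [OF p_le_1] mult_right_mono]) auto
    then obtain k where k: "k \<le> K"
      "t \<le> (1 - exp (- sqrt (2 * t / 2 ^ k))) * (real (card (visits w u)) * p w a)
         - sqrt (2 * t / 2 ^ k) * real (card {i \<in> visits w u. u ! i = a})"
      using exponent_grid [OF _ assms(2), of "real (card {i \<in> visits w u. u ! i = a})"
          "real (card (visits w u)) * p w a" "real n"] lt
      unfolding K_def Let_def by auto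
    define j where "j = Min (visits w u)"
    have "j \<in> visits w u" unfolding j_def using ne by (intro Min_in) auto
    then have j: "j < n" "length w \<le> j" "w = [] \<Longrightarrow> j = 0"
      using u(1) Min_le [of "visits w u" 0]
      by (auto simp: visits_def j_def dest: suffix_length_le)
    have "large ((j, length w), a, k) u"
      using k(2) weight_first_visit [OF ne, of a] by (simp add: large_def j_def)
    moreover have "((j, length w), a, k) \<in> I"
      using j k(1) by (cases "w = []") (auto simp: I_def P_def Suc_le_eq)
    ultimately show ?thesis by blast
  qed
  then have "of_bool (underestimated t u) \<le> (\<Sum>x\<in>I. of_bool (large x u) :: real)" if "length u = n" for u
    using that member_le_sum [OF _ _ \<open>finite I\<close>, of _ "\<lambda>x. of_bool (large x u) :: real"]
    by (cases "underestimated t u") (fastforce intro!: sum_nonneg)+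
  then have "(\<Sum>u | length u = n. Q u * of_bool (underestimated t u))
      \<le> (\<Sum>u | length u = n. Q u * (\<Sum>x\<in>I. of_bool (large x u)))"
    by (intro sum_mono mult_left_mono Q_nonneg) auto
  also have "\<dots> = (\<Sum>x\<in>I. \<Sum>u | length u = n. Q u * of_bool (large x u))"
    unfolding sum_distrib_left by (rule sum.swap)
  also have "\<dots> \<le> (\<Sum>x\<in>I. exp (- t))"
  proof (rule sum_mono)
    fix x assume "x \<in> I"
    then obtain j l a k where x: "x = ((j, l), a, k)" "j \<le> n"
      using assms(1) by (auto simp: I_def P_def)
    show "(\<Sum>u | length u = n. Q u * of_bool (large x u)) \<le> exp (- t)"
      using sum_weight_large_le [OF x(2), of "sqrt (2 * t / 2 ^ k)"] assms(2) by (simp add: x(1) large_def)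
  qed
  also have "\<dots> = real (card I) * exp (- t)" by simp
  also have "\<dots> \<le> (1 + (real n)\<^sup>2 / 2) * real CARD('a) * (1 + log 2 (real n)) * exp (- t)"
    by (intro mult_right_mono cardI) auto
  finally show ?thesis .
qed

end

section \<open>The estimator\<close>

text \<open>\<open>\<bar>p a - q a\<bar>\<close> is \<open>p a + q a\<close> minus twice the
  minimum, and \<open>m a\<close> lies below that minimum.\<close>

lemma dTV_le_common_lower_bound:
  fixes p q m :: "'a::finite \<Rightarrow> real"
  assumes "sum p UNIV = 1" and "sum q UNIV = 1" and "\<And>a. m a \<le> p a" and "\<And>a. m a \<le> q a"
  shows "dTV p q \<le> 1 - sum m UNIV"
proof -
  have "\<bar>p a - q a\<bar> \<le> p a + q a - 2 * m a" for a
    using assms(3,4) [of a] by linarith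
  then have "(\<Sum>a\<in>UNIV. \<bar>p a - q a\<bar>) \<le> (\<Sum>a\<in>UNIV. p a + q a - 2 * m a)"
    by (intro sum_mono)
  also have "\<dots> = 2 - 2 * sum m UNIV"
    using assms(1,2) by (simp add: sum.distrib sum_subtractf sum_distrib_left)
  finally show ?thesis by (simp add: dTV_def)
qed

text \<open>For equal masses the distance is the sum of the positive parts of
  \<open>q a - p a\<close>, each at most \<open>v a - m a\<close>.\<close>

lemma dTV_le_envelope:
  fixes p q m v :: "'a::finite \<Rightarrow> real"
  assumes "sum p UNIV = 1" and "sum q UNIV = 1"
    and "\<And>a. m a \<le> p a" and "\<And>a. q a \<le> v a" and "\<And>a. m a \<le> v a"
  shows "dTV p q \<le> sum v UNIV - sum m UNIV"
proof -
  have "\<bar>p a - q a\<bar> \<le> p a - q a + 2 * (v a - m a)" for a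
    using assms(3) [of a] assms(4) [of a] assms(5) [of a] by (simp add: abs_le_iff)
  then have "(\<Sum>a\<in>UNIV. \<bar>p a - q a\<bar>) \<le> (\<Sum>a\<in>UNIV. p a - q a + 2 * (v a - m a))"
    by (intro sum_mono)
  also have "\<dots> = 2 * (sum v UNIV - sum m UNIV)"
    using assms(1,2) by (simp add: sum.distrib sum_subtractf sum_distrib_left [symmetric])
  finally show ?thesis by (simp add: dTV_def)
qed

section \<open>Empirical probabilities, confidence widths and the mixture built from them\<close>

lemma p_hat_nonneg: "0 \<le> p_hat s n w a"
  by (simp add: p_hat_def)

lemma cf_hat_nonneg: "0 \<le> t_star CARD('a) n \<delta> \<Longrightarrow> 0 \<le> cf_hat s n \<delta> w (a :: 'a::finite)"
  by (simp add: cf_hat_def p_hat_nonneg)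

text \<open>Each visit to \<open>w\<close> is followed by exactly one letter of the sample.\<close>

lemma sum_p_hat:
  fixes s :: "int \<Rightarrow> 'a::finite"
  assumes "n \<ge> 1" and "occ s (n - 1) w > 0"
  shows "(\<Sum>a\<in>UNIV. p_hat s n w a) = 1"
proof -
  let ?u = "block s 1 (int n)"
  have "(\<Sum>a\<in>UNIV. real (occ s n (w @ [a]))) = (\<Sum>a\<in>UNIV. \<Sum>i\<in>visits w ?u. of_bool (?u ! i = a))"
    using assms(1) by (simp add: occ_snoc_eq_card_visits Int_def)
  also have "\<dots> = (\<Sum>i\<in>visits w ?u. \<Sum>a\<in>UNIV. of_bool (?u ! i = a))"
    by (rule sum.swap)
  also have "\<dots> = real (occ s (n - 1) w)"
    unfolding occ_eq_card_visits [OF assms(1)] by simp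
  finally show ?thesis
    using assms(2) by (simp add: p_hat_def sum_divide_distrib [symmetric])
qed

lemma sum_cf_hat_le:
  fixes s :: "int \<Rightarrow> 'a::finite"
  assumes "n \<ge> 1" and "occ s (n - 1) w > 0" and "0 \<le> t_star CARD('a) n \<delta>"
  defines "r \<equiv> real CARD('a) * t_star CARD('a) n \<delta> / real (occ s (n - 1) w)"
  shows "(\<Sum>a\<in>UNIV. cf_hat s n \<delta> w a) \<le> 2 * sqrt r + (2 + sqrt 2) * r"
proof -
  define q where "q = t_star CARD('a) n \<delta> / real (occ s (n - 1) w)"
  have q: "q \<ge> 0" and r: "r = real CARD('a) * q" using assms(3) by (simp_all add: q_def r_def)
  have "(\<Sum>a\<in>UNIV. 1 * sqrt (p_hat s n w a * q))\<^sup>2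
      \<le> (\<Sum>a\<in>(UNIV :: 'a set). 1\<^sup>2) * (\<Sum>a\<in>UNIV. (sqrt (p_hat s n w a * q))\<^sup>2)"
    by (rule Cauchy_Schwarz_ineq_sum)
  also have "\<dots> = r"
    using sum_p_hat [OF assms(1,2)] q by (simp add: p_hat_nonneg sum_distrib_right [symmetric] r)
  finally have "(\<Sum>a\<in>UNIV. sqrt (p_hat s n w a * q)) \<le> sqrt r"
    by (simp add: real_le_rsqrt)
  moreover have "cf_hat s n \<delta> w a = 2 * sqrt (p_hat s n w a * q) + (2 + sqrt 2) * q" for a
    using assms(2) unfolding cf_hat_def q_def by simp
  then have "(\<Sum>a\<in>UNIV. cf_hat s n \<delta> w a)
      = 2 * (\<Sum>a\<in>UNIV. sqrt (p_hat s n w a * q)) + (2 + sqrt 2) * r"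
    by (simp add: sum.distrib sum_distrib_left r)
  ultimately show ?thesis by simp
qed

lemma p_hat_inf_le:
  "suffix w w' \<Longrightarrow> p_hat_inf s n \<delta> w a \<le> p_hat s n w' a + cf_hat s n \<delta> w' a"
  unfolding p_hat_inf_def by (intro Min_le finite_p_hat_inf_values) auto

lemma p_hat_inf_ge:
  assumes "\<And>w'. suffix w w' \<Longrightarrow> q \<le> p_hat s n w' a + cf_hat s n \<delta> w' a"
  shows "q \<le> p_hat_inf s n \<delta> w a"
  unfolding p_hat_inf_def
proof (rule Min.boundedI [OF finite_p_hat_inf_values])
  show "(\<lambda>w'. p_hat s n w' a + cf_hat s n \<delta> w' a) ` {w'. suffix w w'} \<noteq> {}"
    using suffix_order.refl [of w] by blast
qed (use assms in blast)

lemma p_hat_inf_mono: "suffix w w' \<Longrightarrow> p_hat_inf s n \<delta> w a \<le> p_hat_inf s n \<delta> w' a"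
  by (intro p_hat_inf_ge p_hat_inf_le) (rule suffix_order.trans)

lemma p_hat_before_le_at:
  fixes a :: "'a::finite"
  assumes "0 \<le> t_star CARD('a) n \<delta>"
  shows "p_hat_before s n \<delta> x a \<le> p_hat_at s n \<delta> x a"
proof (cases "h_hat s n \<delta> x = 0")
  case True
  have "0 \<le> p_hat_inf s n \<delta> w a" for w
    by (intro p_hat_inf_ge add_nonneg_nonneg p_hat_nonneg cf_hat_nonneg assms)
  with True show ?thesis by (simp add: p_hat_before_def p_hat_at_def)
next
  case False
  then show ?thesis
    by (simp add: p_hat_before_def p_hat_at_def p_hat_inf_mono suffix_past)
qed

text \<open>By minimality of \<open>h_hat\<close> the total is below 1 one level earlier and at
  least 1 at \<open>h_hat\<close>. Hence \<open>z_hat / Z_hat\<close> is a mixing weight in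
  (0,1].\<close>

lemma z_hat_bounds: "0 < z_hat s n \<delta> x" "z_hat s n \<delta> x \<le> Z_hat s n \<delta> x"
proof -
  let ?S = "\<lambda>h. \<Sum>a\<in>UNIV. p_hat_inf s n \<delta> (past x h) a"
  have "?S (h_hat s n \<delta> x) \<ge> 1"
    unfolding h_hat_def by (rule LeastI [of "\<lambda>h. ?S h \<ge> 1"]) (rule h_hat_exists)
  then show "z_hat s n \<delta> x \<le> Z_hat s n \<delta> x"
    by (simp add: z_hat_def Z_hat_def sum_subtractf p_hat_at_def)
  show "0 < z_hat s n \<delta> x"
    using not_less_Least [of "h_hat s n \<delta> x - 1" "\<lambda>h. ?S h \<ge> 1"]
    by (cases "h_hat s n \<delta> x = 0") (simp_all add: z_hat_def p_hat_before_def h_hat_def)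
qed

text \<open>The mixture adds to \<open>p_hat_before\<close> the mass
  \<open>z_hat / Z_hat * Z_hat\<close>, which is what \<open>p_hat_before\<close> lacks to
  1.\<close>

lemma sum_P_hat: "(\<Sum>a\<in>UNIV. P_hat s n \<delta> x a) = 1"
proof -
  let ?r = "z_hat s n \<delta> x / Z_hat s n \<delta> x"
  have "P_hat s n \<delta> x a = p_hat_before s n \<delta> x a + ?r * (p_hat_at s n \<delta> x a - p_hat_before s n \<delta> x a)" for a
    by (simp add: P_hat_def algebra_simps)
  then have "(\<Sum>a\<in>UNIV. P_hat s n \<delta> x a) = (\<Sum>a\<in>UNIV. p_hat_before s n \<delta> x a) + ?r * Z_hat s n \<delta> x"
    by (simp add: sum.distrib sum_distrib_left Z_hat_def)
  then show ?thesis
    using Z_hat_pos [of s n \<delta> x] by (simp add: z_hat_def)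
qed

lemma P_hat_between:
  fixes a :: "'a::finite"
  assumes "0 \<le> t_star CARD('a) n \<delta>"
  shows "p_hat_before s n \<delta> x a \<le> P_hat s n \<delta> x a" "P_hat s n \<delta> x a \<le> p_hat_at s n \<delta> x a"
proof -
  define r where "r = z_hat s n \<delta> x / Z_hat s n \<delta> x"
  have r: "0 \<le> r" "r \<le> 1"
    using z_hat_bounds [of s n \<delta> x] Z_hat_pos [of s n \<delta> x] by (simp_all add: r_def)
  have d: "0 \<le> p_hat_at s n \<delta> x a - p_hat_before s n \<delta> x a"
    using p_hat_before_le_at [OF assms] by simp
  have "P_hat s n \<delta> x a = p_hat_before s n \<delta> x a + r * (p_hat_at s n \<delta> x a - p_hat_before s n \<delta> x a)"
    by (simp add: P_hat_def r_def algebra_simps)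
  then show "p_hat_before s n \<delta> x a \<le> P_hat s n \<delta> x a" "P_hat s n \<delta> x a \<le> p_hat_at s n \<delta> x a"
    using mult_nonneg_nonneg [OF r(1) d] mult_left_le_one_le [OF d r] by linarith+
qed

text \<open>The deterministic half of the argument, for a sample on which \<open>good\<close> holds.
  It is applied with \<open>p_inf\<close> as \<open>m\<close> and the transition probabilities as
  \<open>p\<close>.\<close>

lemma P_hat_error_le:
  fixes s x :: "int \<Rightarrow> 'a::finite" and p :: "'a \<Rightarrow> real" and m :: "'a list \<Rightarrow> 'a \<Rightarrow> real"
  assumes "n \<ge> 1" and t: "0 \<le> t_star CARD('a) n \<delta>"
    and p: "sum p UNIV = 1" "\<And>a. m (past x L) a \<le> p a"
    and m: "\<And>w a. 0 \<le> m w a" "\<And>w w' a. suffix w w' \<Longrightarrow> m w a \<le> m w' a"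
    and good: "\<And>w a. m w a \<le> p_hat s n w a + cf_hat s n \<delta> w a"
    and occ: "occ s (n - 1) (past x L) > 0"
  shows "dTV p (P_hat s n \<delta> x) \<le> 1 - (\<Sum>a\<in>UNIV. m (past x L) a)
    + (8 + 2 * sqrt 2) * sqrt (real CARD('a) * t_star CARD('a) n \<delta> / real (occ s (n - 1) (past x L)))"
proof -
  define r where "r = real CARD('a) * t_star CARD('a) n \<delta> / real (occ s (n - 1) (past x L))"
  have r: "0 \<le> r" using t by (simp add: r_def)
  have inf: "m w a \<le> p_hat_inf s n \<delta> w a" for w a
    by (rule p_hat_inf_ge) (use m(2) good order.trans in blast)
  show ?thesis
  proof (cases "L < h_hat s n \<delta> x")
    case True
    then have "L \<le> h_hat s n \<delta> x - 1" by simp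
    then have "p_hat_inf s n \<delta> (past x L) a \<le> p_hat_before s n \<delta> x a" for a
      using True by (simp add: p_hat_before_def p_hat_inf_mono suffix_past)
    then have "m (past x L) a \<le> P_hat s n \<delta> x a" for a
      using inf P_hat_between(1) [OF t] by (meson order.trans)
    then have "dTV p (P_hat s n \<delta> x) \<le> 1 - (\<Sum>a\<in>UNIV. m (past x L) a)"
      by (intro dTV_le_common_lower_bound p sum_P_hat)
    then show ?thesis using r by (simp add: r_def add_increasing2)
  next
    case False
    show ?thesis
    proof (cases "r \<le> 1")
      case True
      let ?v = "\<lambda>a. p_hat s n (past x L) a + cf_hat s n \<delta> (past x L) a"
      have "P_hat s n \<delta> x a \<le> ?v a" for a
        using False P_hat_between(2) [OF t, of s x a]
          p_hat_inf_le [OF suffix_past [of "h_hat s n \<delta> x" L x], of s n \<delta> a]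
        by (simp add: p_hat_at_def)
      then have "dTV p (P_hat s n \<delta> x) \<le> sum ?v UNIV - (\<Sum>a\<in>UNIV. m (past x L) a)"
        by (intro dTV_le_envelope p sum_P_hat good)
      also have "sum ?v UNIV \<le> 1 + (2 * sqrt r + (2 + sqrt 2) * r)"
        using sum_p_hat [OF assms(1) occ] sum_cf_hat_le [OF assms(1) occ t]
        by (simp add: sum.distrib r_def)
      \<comment> \<open>For \<open>r \<le> 1\<close> the linear term is absorbed by the square root;
        the resulting coefficient \<open>4 + sqrt 2\<close> is half the stated one.\<close>
      also have "(2 + sqrt 2) * r \<le> (2 + sqrt 2) * sqrt r"
        using r True by (intro mult_left_mono real_le_rsqrt) (simp_all add: power2_eq_square mult_left_le)
      also have "1 + (2 * sqrt r + (2 + sqrt 2) * sqrt r) \<le> 1 + (8 + 2 * sqrt 2) * sqrt r"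
        using r by (simp add: algebra_simps)
      finally show ?thesis by (simp add: r_def)
    next
      case False
      \<comment> \<open>For \<open>r > 1\<close> the right-hand side exceeds 1, so it suffices that
        both vectors are probability distributions.\<close>
      have "0 \<le> p_hat_before s n \<delta> x a" for a
        using order.trans [OF m(1) inf] by (simp add: p_hat_before_def)
      then have "0 \<le> P_hat s n \<delta> x a" for a
        using P_hat_between(1) [OF t] by (rule order.trans)
      then have "dTV p (P_hat s n \<delta> x) \<le> 1 - (\<Sum>a\<in>(UNIV :: 'a set). 0)"
        by (intro dTV_le_common_lower_bound p sum_P_hat) (use m(1) p(2) order.trans in blast)
      also have "\<dots> \<le> (8 + 2 * sqrt 2) * sqrt r"
        using False mult_mono [of 1 "8 + 2 * sqrt 2" 1 "sqrt r"] by simp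
      also have "\<dots> \<le> 1 - (\<Sum>a\<in>UNIV. m (past x L) a) + (8 + 2 * sqrt 2) * sqrt r"
        using sum_mono [of UNIV "m (past x L)" p] p by simp
      finally show ?thesis by (simp add: r_def)
    qed
  qed
qed

section \<open>Infima of transition probabilities\<close>

context prob_space
begin

lemma trans_prob_bounds: "0 \<le> trans_prob M X w a" "trans_prob M X w a \<le> 1"
proof -
  show "0 \<le> trans_prob M X w a"
    by (simp add: trans_prob_def cond_prob_def)
  let ?B = "{\<omega> \<in> space M. past (\<lambda>i. X i \<omega>) (length w) = w}"
  define P where "P = \<P>(\<omega> in M. X 0 \<omega> = a \<and> past (\<lambda>i. X i \<omega>) (length w) = w)"
  \<comment> \<open>If \<open>?B\<close> is not measurable, \<open>prob ?B\<close> is 0, and the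
    quotient below is 0 as well.\<close>
  have "P \<le> prob ?B \<or> prob ?B = 0"
  proof (cases "?B \<in> sets M")
    case True
    then show ?thesis unfolding P_def by (intro disjI1 finite_measure_mono) auto
  qed (simp add: measure_notin_sets)
  then have "P / prob ?B \<le> 1"
    by (auto simp: divide_le_eq_1 zero_less_measure_iff)
  then show "trans_prob M X w a \<le> 1"
    by (simp add: trans_prob_def cond_prob_def P_def)
qed

lemma p_inf_supp_le:
  assumes "w' \<in> supp M X" and "suffix w w'"
  shows "p_inf_supp M X w a \<le> trans_prob M X w' a"
  unfolding p_inf_supp_def
  using assms by (intro cINF_lower bdd_belowI2 [where m = 0] trans_prob_bounds) simp

lemma p_inf_supp_mono:
  assumes "w' \<in> supp M X" and "suffix w w'"
  shows "p_inf_supp M X w a \<le> p_inf_supp M X w' a"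
  unfolding p_inf_supp_def [of M X w']
proof (rule cINF_greatest)
  show "{v \<in> supp M X. suffix w' v} \<noteq> {}" using assms(1) by auto
  show "p_inf_supp M X w a \<le> trans_prob M X v a" if "v \<in> {v \<in> supp M X. suffix w' v}" for v
    using that suffix_order.trans [OF assms(2)] by (intro p_inf_supp_le) auto
qed

text \<open>Unites both branches of \<open>p_inf\<close>: a supported \<open>w\<close> is its own
  longest supported suffix. Suffixes of one word are nested, so greatest length means greatest in
  the suffix order.\<close>

lemma p_inf_eq_longest:
  obtains u where "suffix u w" and "u \<in> supp M X" and "p_inf M X w = p_inf_supp M X u"
    and "\<And>v. suffix v w \<Longrightarrow> v \<in> supp M X \<Longrightarrow> suffix v u"
proof -
  define u where "u = (ARG_MAX length u. suffix u w \<and> u \<in> supp M X)"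
  note longest = longest_suffix_in_supp [OF prob_space_axioms, where w = w and X = X, folded u_def]
  have "suffix v u" if "suffix v w" "v \<in> supp M X" for v
    using longest that by (blast intro: suffix_length_suffix)
  moreover have "p_inf M X w = p_inf_supp M X u"
  proof (cases "w \<in> supp M X")
    case True
    then have "u = w" using calculation [of w] longest by (auto intro: suffix_order.antisym)
    with True show ?thesis by (simp add: p_inf_def fun_eq_iff)
  next
    case False
    then show ?thesis by (simp add: p_inf_def fun_eq_iff u_def)
  qed
  ultimately show ?thesis using that longest by blast
qed

text \<open>The longest supported suffix of \<open>w\<close> is also a suffix of \<open>w'\<close>,
  hence of the longest supported suffix of \<open>w'\<close>.\<close>

lemma p_inf_mono:
  assumes "suffix w w'"
  shows "p_inf M X w a \<le> p_inf M X w' a"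
proof -
  obtain u where u: "suffix u w" "u \<in> supp M X" "p_inf M X w = p_inf_supp M X u"
    by (rule p_inf_eq_longest)
  obtain u' where u': "suffix u' w'" "u' \<in> supp M X" "p_inf M X w' = p_inf_supp M X u'"
    "\<And>v. suffix v w' \<Longrightarrow> v \<in> supp M X \<Longrightarrow> suffix v u'"
    by (rule p_inf_eq_longest [where w = w' and X = X]) blast
  have "suffix u u'"
    using u u' assms by (blast intro: suffix_order.trans)
  then show ?thesis using u u' by (simp add: p_inf_supp_mono)
qed

lemma p_inf_le_trans_prob:
  assumes "w' \<in> supp M X" and "suffix w w'"
  shows "p_inf M X w a \<le> trans_prob M X w' a"
proof -
  obtain u where u: "suffix u w" "u \<in> supp M X" "p_inf M X w = p_inf_supp M X u"
    by (rule p_inf_eq_longest)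
  then show ?thesis
    using assms by (auto intro: p_inf_supp_le suffix_order.trans)
qed

lemma p_inf_nonneg: "0 \<le> p_inf M X w a"
proof -
  obtain u where u: "u \<in> supp M X" "p_inf M X w = p_inf_supp M X u"
    by (rule p_inf_eq_longest)
  have "0 \<le> p_inf_supp M X u a"
    unfolding p_inf_supp_def by (rule cINF_greatest) (use u(1) trans_prob_bounds in auto)
  then show ?thesis by (simp add: u(2))
qed

text \<open>One \<open>u\<close> serves all letters, which allows summation over
  \<open>a\<close>.\<close>

lemma p_inf_le_trans_prob_longest:
  obtains u where "u \<in> supp M X" and "\<And>a. p_inf M X w a \<le> trans_prob M X u a"
proof -
  obtain u where "u \<in> supp M X" "p_inf M X w = p_inf_supp M X u"
    by (rule p_inf_eq_longest)
  then show ?thesis using that by (simp add: p_inf_supp_le)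
qed

lemma p_inf_le_1: "p_inf M X w a \<le> 1"
proof -
  obtain u where "p_inf M X w a \<le> trans_prob M X u a"
    by (rule p_inf_le_trans_prob_longest [where w = w and X = X]) blast
  then show ?thesis using trans_prob_bounds(2) by (rule order.trans)
qed

text \<open>Monotone bounded convergence along deeper pasts; it gives the \<open>lim\<close> in
  \<open>p_limit\<close> its intended meaning.\<close>

lemma p_inf_tendsto: "(\<lambda>k. p_inf M X (past x k) a) \<longlonglongrightarrow> p_limit M X x a"
  and p_inf_le_p_limit: "p_inf M X (past x k) a \<le> p_limit M X x a"
proof -
  have mono: "incseq (\<lambda>k. p_inf M X (past x k) a)"
    by (intro incseq_SucI p_inf_mono suffix_past) simp
  have "norm (p_inf M X (past x k) a) \<le> 1" for k
    by (simp add: abs_of_nonneg p_inf_nonneg p_inf_le_1)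
  then have "convergent (\<lambda>k. p_inf M X (past x k) a)"
    by (rule Bseq_mono_convergent [OF BseqI']) (use mono in \<open>auto simp: incseq_def\<close>)
  then show lim: "(\<lambda>k. p_inf M X (past x k) a) \<longlonglongrightarrow> p_limit M X x a"
    by (simp add: p_limit_def convergent_LIMSEQ_iff)
  show "p_inf M X (past x k) a \<le> p_limit M X x a"
    by (rule incseq_le [OF mono lim])
qed

end

section \<open>The law of a sample from a stationary process\<close>

locale stationary_process = prob_space M for M :: "'w measure" +
  fixes X :: "int \<Rightarrow> 'w \<Rightarrow> 'a::finite"
  assumes X_measurable [measurable]: "X i \<in> measurable M (count_space UNIV)"
    and stationary: "stationary M X"
begin

text \<open>Stated for any measurable family, since it is applied both to \<open>X\<close> and to
  the coordinates of the product space.\<close>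

lemma pred_map_eq:
  fixes Y :: "int \<Rightarrow> 'c \<Rightarrow> 'a"
  assumes [measurable]: "\<And>i. Y i \<in> measurable N (count_space UNIV)"
  shows "Measurable.pred N (\<lambda>\<omega>. map (\<lambda>i. Y i \<omega>) is = w)"
proof (induction "is" arbitrary: w)
  case (Cons i "is")
  note Cons [measurable]
  show ?case
    by (cases w) simp_all
qed simp

lemma pred_block_eq [measurable]: "Measurable.pred M (\<lambda>\<omega>. block (\<lambda>i. X i \<omega>) i j = w)"
  unfolding block_def by (intro pred_map_eq X_measurable)

lemma pred_past_eq [measurable]: "Measurable.pred M (\<lambda>\<omega>. past (\<lambda>i. X i \<omega>) k = w)"
  unfolding past_def by (rule pred_block_eq)

lemma prob_block_shift:
  "\<P>(\<omega> in M. block (\<lambda>i. X i \<omega>) (i + m) (j + m) = w) = \<P>(\<omega> in M. block (\<lambda>i. X i \<omega>) i j = w)"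
proof -
  let ?N = "\<Pi>\<^sub>M i\<in>(UNIV :: int set). count_space (UNIV :: 'a set)"
  let ?S = "{y \<in> space ?N. block y i j = w}"
  have pred: "Measurable.pred ?N (\<lambda>y. block y i j = w)"
    unfolding block_def using pred_map_eq [of "\<lambda>i y. y i" ?N] by simp
  then have S: "?S \<in> sets ?N" by (simp add: pred_def)
  have "measure (distr M ?N (\<lambda>\<omega> i. X (i + m) \<omega>)) ?S = \<P>(\<omega> in M. block (\<lambda>i. X (i + m) \<omega>) i j = w)" for m
    using S by (subst measure_distr)
      (auto intro!: arg_cong [of _ _ prob] measurable_PiM_single' simp: space_PiM)
  from this [of m] this [of 0] show ?thesis
    using stationary block_shift [of "\<lambda>i. X i \<omega>" m i j for \<omega>] by (simp add: stationary_def)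
qed

definition word_prob :: "'a list \<Rightarrow> real" where
  "word_prob u = \<P>(\<omega> in M. past (\<lambda>i. X i \<omega>) (length u) = u)"

text \<open>Transfers word probabilities from the past, where \<open>supp\<close> and
  \<open>trans_prob\<close> live, to the sample.\<close>

lemma prob_block: "\<P>(\<omega> in M. block (\<lambda>i. X i \<omega>) 1 (int (length u)) = u) = word_prob u"
proof -
  have bounds: "- int (length u) + (int (length u) + 1) = 1" "-1 + (int (length u) + 1) = int (length u)"
    by simp_all
  show ?thesis
    using prob_block_shift [of "- int (length u)" "int (length u) + 1" "-1" u]
    unfolding bounds word_prob_def past_def .
qed

lemma word_prob_snoc:
  "word_prob (u @ [a]) = \<P>(\<omega> in M. X 0 \<omega> = a \<and> past (\<lambda>i. X i \<omega>) (length u) = u)"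
proof -
  have "block (\<lambda>i. X i \<omega>) (- int (length u)) 0 = u @ [a]
      \<longleftrightarrow> X 0 \<omega> = a \<and> past (\<lambda>i. X i \<omega>) (length u) = u" for \<omega>
    using block_snoc [of "- int (length u)" "-1" "\<lambda>i. X i \<omega>"] by (auto simp: past_def)
  then show ?thesis
    using prob_block_shift [of "- int (Suc (length u))" 1 "-1" "u @ [a]"]
    by (simp add: word_prob_def past_def)
qed

lemma sum_word_prob_snoc: "(\<Sum>a\<in>UNIV. word_prob (u @ [a])) = word_prob u"
proof -
  let ?E = "\<lambda>a. {\<omega> \<in> space M. X 0 \<omega> = a \<and> past (\<lambda>i. X i \<omega>) (length u) = u}"
  have "prob (\<Union>a\<in>UNIV. ?E a) = (\<Sum>a\<in>UNIV. prob (?E a))"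
    by (rule finite_measure_finite_Union) (auto simp: disjoint_family_on_def)
  moreover have "(\<Union>a\<in>UNIV. ?E a) = {\<omega> \<in> space M. past (\<lambda>i. X i \<omega>) (length u) = u}"
    by auto
  ultimately show ?thesis
    unfolding word_prob_snoc by (simp add: word_prob_def)
qed

lemma trans_prob_eq: "trans_prob M X u a = word_prob (u @ [a]) / word_prob u"
  unfolding word_prob_snoc by (simp add: trans_prob_def cond_prob_def word_prob_def)

lemma supp_iff: "u \<in> supp M X \<longleftrightarrow> word_prob u > 0"
  by (simp add: supp_def word_prob_def)

lemma sum_p_inf_le_1: "(\<Sum>a\<in>UNIV. p_inf M X w a) \<le> 1"
proof -
  obtain u where u: "u \<in> supp M X" "\<And>a. p_inf M X w a \<le> trans_prob M X u a"
    by (rule p_inf_le_trans_prob_longest [of X w]) blast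
  then have "(\<Sum>a\<in>UNIV. p_inf M X w a) \<le> (\<Sum>a\<in>UNIV. trans_prob M X u a)"
    by (intro sum_mono)
  also have "\<dots> = 1"
    using u(1) by (simp add: trans_prob_eq sum_divide_distrib [symmetric] sum_word_prob_snoc supp_iff)
  finally show ?thesis .
qed

lemma sum_trans_prob_past: "(\<Sum>a\<in>UNIV. trans_prob_past M X x a) = 1"
  by (simp add: trans_prob_past_def sum.distrib)

text \<open>The limits sum to at most 1, so the uniform share of the missing mass added in
  \<open>trans_prob_past\<close> is nonnegative.\<close>

lemma p_inf_le_trans_prob_past: "p_inf M X (past x k) a \<le> trans_prob_past M X x a"
proof -
  have "(\<lambda>k. \<Sum>b\<in>UNIV. p_inf M X (past x k) b) \<longlonglongrightarrow> (\<Sum>b\<in>UNIV. p_limit M X x b)"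
    by (intro tendsto_sum p_inf_tendsto)
  then have "(\<Sum>b\<in>UNIV. p_limit M X x b) \<le> 1"
    by (rule LIMSEQ_le_const2) (use sum_p_inf_le_1 in blast)
  then show ?thesis
    using p_inf_le_p_limit [of X x k a] by (simp add: trans_prob_past_def add_increasing2)
qed

sublocale word_chain word_prob "p_inf M X"
proof
  show nonneg: "0 \<le> word_prob u" for u by (simp add: word_prob_def)
  show "word_prob [] = 1" by (simp add: word_prob_def past_def block_def prob_space)
  show "(\<Sum>b\<in>UNIV. word_prob (u @ [b])) = word_prob u" for u by (rule sum_word_prob_snoc)
  show "p_inf M X w a \<le> 1" for w a by (rule p_inf_le_1)
  show "p_inf M X w a * word_prob u \<le> word_prob (u @ [a])" if "suffix w u" for w u a
  proof (cases "u \<in> supp M X")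
    case True
    then have "word_prob u > 0" by (simp add: supp_iff)
    then show ?thesis
      using p_inf_le_trans_prob [OF True that, of a]
      unfolding trans_prob_eq by (simp only: pos_le_divide_eq)
  next
    case False
    then have "word_prob u = 0"
      using nonneg [of u] by (simp add: supp_iff not_less)
    then show ?thesis using nonneg [of "u @ [a]"] by simp
  qed
qed

text \<open>The sample takes finitely many values, so any \<open>R\<close> whatsoever yields a
  finite union of measurable events. This settles the measurability of an event quantified over all
  infinite pasts.\<close>

lemma prob_block_pred:
  "\<P>(\<omega> in M. R (block (\<lambda>i. X i \<omega>) 1 (int n))) = (\<Sum>u | length u = n. word_prob u * of_bool (R u))"
proof -
  let ?E = "\<lambda>u. {\<omega> \<in> space M. block (\<lambda>i. X i \<omega>) 1 (int n) = u}"
  have "R (block (\<lambda>i. X i \<omega>) 1 (int n))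
      \<longleftrightarrow> (\<exists>u. (length u = n \<and> R u) \<and> block (\<lambda>i. X i \<omega>) 1 (int n) = u)" for \<omega>
    by simp
  then have "{\<omega> \<in> space M. R (block (\<lambda>i. X i \<omega>) 1 (int n))} = (\<Union>u\<in>{u. length u = n \<and> R u}. ?E u)"
    by blast
  moreover have fin: "finite {u :: 'a list. length u = n \<and> R u}"
    by (rule finite_subset [OF _ finite_words [of n]]) auto
  then have "prob (\<Union>u\<in>{u. length u = n \<and> R u}. ?E u) = (\<Sum>u | length u = n \<and> R u. prob (?E u))"
    by (intro finite_measure_finite_Union) (auto simp: disjoint_family_on_def)
  moreover have "\<dots> = (\<Sum>u | length u = n \<and> R u. word_prob u)"
    by (intro sum.cong) (auto simp flip: prob_block)
  moreover have "\<dots> = (\<Sum>u | length u = n. word_prob u * of_bool (R u))"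
    by (intro sum.mono_neutral_cong_left) auto
  ultimately show ?thesis by simp
qed

lemma p_inf_le_estimate:
  assumes "n \<ge> 1" and t: "0 \<le> t_star CARD('a) n \<delta>"
    and "\<not> underestimated (t_star CARD('a) n \<delta>) (block s 1 (int n))"
  shows "p_inf M X w a \<le> p_hat s n w a + cf_hat s n \<delta> w a"
proof (cases "occ s (n - 1) w = 0")
  \<comment> \<open>For an unvisited word the defaults give \<open>1 / CARD('a) + 1\<close>, which
    exceeds every probability.\<close>
  case True
  then show ?thesis
    using p_inf_le_1 [of X w a] by (simp add: p_hat_def cf_hat_def add_increasing)
next
  case False
  define N where "N = real (occ s (n - 1) w)"
  define S where "S = real (occ s n (w @ [a]))"
  define t where "t = t_star CARD('a) n \<delta>"
  have N: "N > 0" using False by (simp add: N_def)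
  have "visits w (block s 1 (int n)) \<noteq> {}"
    using False unfolding occ_eq_card_visits [OF assms(1)] by auto
  then have "N * p_inf M X w a \<le> S + 2 * sqrt (S * t) + (2 + sqrt 2) * t"
    using assms(3)
    unfolding underestimated_def N_def S_def t_def occ_eq_card_visits [OF assms(1)]
      occ_snoc_eq_card_visits [OF assms(1)]
    by (auto simp: Let_def not_less)
  then have "p_inf M X w a \<le> (S + 2 * sqrt (S * t) + (2 + sqrt 2) * t) / N"
    using N by (simp add: pos_le_divide_eq mult.commute)
  also have "\<dots> = S / N + 2 * (sqrt (S * t) / N) + (2 + sqrt 2) * (t / N)"
    by (simp add: add_divide_distrib)
  also have "sqrt (S * t) / N = sqrt (S / N * (t / N))"
    using N by (simp add: real_sqrt_divide)
  finally show ?thesis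
    using False unfolding p_hat_def cf_hat_def N_def S_def t_def by simp
qed

end

section \<open>Calibration of the threshold and conclusion\<close>

lemma t_star_bounds:
  assumes "A \<ge> 1" and "n \<ge> 1" and "0 < \<delta>" and "\<delta> < 1"
  shows "1 \<le> t_star A n \<delta>"
    and "(1 + (real n)\<^sup>2 / 2) * real A * (1 + log 2 (real n)) * exp (- t_star A n \<delta>) \<le> \<delta>"
proof -
  define l where "l = log 2 (real n)"
  define q where "q = real A * (14 + 2 * l) * (1 + (real n)\<^sup>2 / 2)"
  have l: "0 \<le> l" using assms(2) by (simp add: l_def)
  \<comment> \<open>The constant 14 exceeds \<open>exp 1\<close>, whence \<open>t_star\<close> is at
    least 1.\<close>
  have "1 * 14 * 1 \<le> q"
    unfolding q_def using l assms(1) by (intro mult_mono) auto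
  moreover have "q * 1 \<le> q / \<delta>"
    using calculation assms(3,4) by (simp add: field_simps mult_left_le)
  ultimately have "exp 1 \<le> q / \<delta>" "q > 0"
    using exp_le by linarith+
  then show "1 \<le> t_star A n \<delta>"
    using assms(3) unfolding t_star_def l_def [symmetric] q_def [symmetric]
    by (subst ln_ge_iff) auto
  have "exp (- t_star A n \<delta>) = \<delta> / q"
    using \<open>q > 0\<close> assms(3) unfolding t_star_def l_def [symmetric] q_def [symmetric]
    by (simp add: exp_minus)
  \<comment> \<open>Here \<open>1 + l \<le> 14 + 2 * l\<close> shows that \<open>q\<close> dominates
    the bound on the number of events in the union bound, each of probability at most
    \<open>\<delta> / q\<close>.\<close>
  moreover have "(1 + (real n)\<^sup>2 / 2) * real A * (1 + l) \<le> (1 + (real n)\<^sup>2 / 2) * real A * (14 + 2 * l)"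
    using l by (intro mult_left_mono) auto
  then have "(1 + (real n)\<^sup>2 / 2) * real A * (1 + l) \<le> q"
    by (simp add: q_def mult_ac)
  then have "(1 + (real n)\<^sup>2 / 2) * real A * (1 + l) * (\<delta> / q) \<le> q * (\<delta> / q)"
    using \<open>q > 0\<close> assms(3) by (intro mult_right_mono) auto
  ultimately show "(1 + (real n)\<^sup>2 / 2) * real A * (1 + log 2 (real n)) * exp (- t_star A n \<delta>) \<le> \<delta>"
    using \<open>q > 0\<close> by (simp add: l_def)
qed

theorem theorem2:
  fixes M :: "'w measure"
    and X :: "int \<Rightarrow> 'w \<Rightarrow> 'a::finite"
    and n :: nat and \<delta> :: real
  assumes "prob_space M"
    and "\<And>i. X i \<in> measurable M (count_space UNIV)"
    and "stationary M X"
    and "as_continuous M X"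
    and "n \<ge> 1" and "0 < \<delta>" and "\<delta> < 1"
  shows "\<P>(\<omega> in M. \<forall>x :: int \<Rightarrow> 'a.
           ereal (dTV (trans_prob_past M X x) (P_hat (\<lambda>i. X i \<omega>) n \<delta> x))
           \<le> (INF L :: nat.
                ereal (1 - (\<Sum>a\<in>UNIV. p_inf M X (past x L) a))
                + ereal (8 + 2 * sqrt 2)
                  * sqrt_ratio (real CARD('a) * t_star CARD('a) n \<delta>)
                      (occ (\<lambda>i. X i \<omega>) (n - 1) (past x L))))
         \<ge> 1 - \<delta>"
proof -
  interpret stationary_process M X
    using assms by (simp add: stationary_process_def stationary_process_axioms_def)
  define t where "t = t_star CARD('a) n \<delta>"
  define E where "E s \<longleftrightarrow> (\<forall>x :: int \<Rightarrow> 'a.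
           ereal (dTV (trans_prob_past M X x) (P_hat s n \<delta> x))
           \<le> (INF L :: nat.
                ereal (1 - (\<Sum>a\<in>UNIV. p_inf M X (past x L) a))
                + ereal (8 + 2 * sqrt 2)
                  * sqrt_ratio (real CARD('a) * t_star CARD('a) n \<delta>)
                      (occ s (n - 1) (past x L))))" for s
  \<comment> \<open>Turns a word back into a sequence whose letters at times 1, 2, ... are those of
    the word.\<close>
  define seq :: "'a list \<Rightarrow> int \<Rightarrow> 'a" where "seq u i = u ! nat (i - 1)" for u i
  have "CARD('a) \<ge> 1" by (simp add: Suc_le_eq)
  note t = t_star_bounds [OF this assms(5-7), folded t_def]
  have good: "E s" if s: "\<not> underestimated t (block s 1 (int n))" for s
    unfolding E_def
  proof (intro allI INF_greatest)
    fix x :: "int \<Rightarrow> 'a" and L :: nat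
    have t0: "0 \<le> t_star CARD('a) n \<delta>" using t(1) by (simp add: t_def)
    show "ereal (dTV (trans_prob_past M X x) (P_hat s n \<delta> x))
        \<le> ereal (1 - (\<Sum>a\<in>UNIV. p_inf M X (past x L) a))
          + ereal (8 + 2 * sqrt 2)
            * sqrt_ratio (real CARD('a) * t_star CARD('a) n \<delta>) (occ s (n - 1) (past x L))"
    proof (cases "occ s (n - 1) (past x L) = 0")
      case True
      \<comment> \<open>Positivity of the constant makes its product with \<open>\<infinity>\<close>
        infinite, so the bound is trivial at this depth.\<close>
      have "(0 :: real) < 8 + 2 * sqrt 2" by (simp add: add_pos_nonneg)
      with True show ?thesis by (simp add: sqrt_ratio_def)
    next
      case False
      then have "dTV (trans_prob_past M X x) (P_hat s n \<delta> x) \<le> 1 - (\<Sum>a\<in>UNIV. p_inf M X (past x L) a)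
          + (8 + 2 * sqrt 2)
            * sqrt (real CARD('a) * t_star CARD('a) n \<delta> / real (occ s (n - 1) (past x L)))"
        using s
        by (intro P_hat_error_le assms(5) t0 sum_trans_prob_past p_inf_le_trans_prob_past
            p_inf_nonneg p_inf_mono p_inf_le_estimate) (auto simp: t_def)
      with False show ?thesis by (simp add: sqrt_ratio_def)
    qed
  qed
  \<comment> \<open>\<open>E\<close> reads its argument only at times 1 to \<open>n\<close>, so it
    is a property of the sample word.\<close>
  have seq: "E (seq (block s 1 (int n))) \<longleftrightarrow> E s" for s
  proof -
    have eq: "seq (block s 1 (int n)) i = s i" if "1 \<le> i" "i \<le> int n" for i
      using that by (simp add: seq_def block_def nth_upto)
    have "P_hat (seq (block s 1 (int n))) n = P_hat s n"
      by (intro P_hat_cong eq)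
    moreover have "occ (seq (block s 1 (int n))) (n - 1) w = occ s (n - 1) w" for w
      by (intro occ_cong eq) auto
    ultimately show ?thesis by (simp add: E_def)
  qed
  \<comment> \<open>The complement is taken word by word; only the final sum is turned back into an
    event.\<close>
  have "1 - \<delta> \<le> (\<Sum>u | length u = n. word_prob u) - (\<Sum>u | length u = n. word_prob u * of_bool (underestimated t u))"
    using sum_underestimated_le [OF assms(5) t(1)] t(2) by (simp add: sum_Q)
  also have "\<dots> \<le> (\<Sum>u | length u = n. word_prob u * of_bool (E (seq u)))"
    unfolding sum_subtractf [symmetric]
  proof (intro sum_mono)
    fix u :: "'a list" assume "u \<in> {u. length u = n}"
    then have "block (seq u) 1 (int n) = u"
      by (intro nth_equalityI) (auto simp: block_def seq_def nth_upto)
    then show "word_prob u - word_prob u * of_bool (underestimated t u) \<le> word_prob u * of_bool (E (seq u))"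
      using good [of "seq u"] Q_nonneg [of u] by (cases "underestimated t u") auto
  qed
  also have "\<dots> = \<P>(\<omega> in M. E (\<lambda>i. X i \<omega>))"
    unfolding prob_block_pred [symmetric] by (simp add: seq)
  finally show ?thesis unfolding E_def .
qed

end
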